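(* Let $l$ and $k$ be two positive integers. Then a positive real number $\alpha$ satisfies $$\alpha^{l+k}-\alpha^{l}\in \mathbb{Z}\cap [1,2^{l/k})$$ if and only if the identity $$[[n\alpha^l]\alpha^k]+1 = [n\alpha^{l+k}]$$ holds for all $n\in\mathbb{Z}\setminus\{0\}$.
   Context: For a real number $x$, $[x]$ denotes its integer part (the largest integer not exceeding $x$). *)

theory Defs
  imports Complex_Main
begin

end

theory Submission
  imports Defs "HOL-Analysis.Kronecker_Approximation_Theorem"
begin

text \<open>
  Put \<open>a = \<alpha>\<^sup>l\<close> and \<open>b = \<alpha>\<^sup>k\<close>. For each \<open>n\<close> the identity says that
  \<open>{n a} b - 1 \<le> {n a b} < {n a} b\<close>. If \<open>a b - a\<close> is an integer then \<open>{n a b} = {n a}\<close>, and the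
  inequalities hold as soon as \<open>1 < b < 2\<close> and \<open>a\<close> is irrational. Conversely, the inequalities for
  \<open>n\<close> and \<open>-n\<close> force \<open>a\<close> and \<open>a b\<close> to be irrational and \<open>1 < b < 2\<close>, and they confine
  \<open>E n = {n a b} - {n a}\<close> to an interval of length \<open>b - 1 < 1\<close> around which it cannot wrap. Hence
  \<open>E\<close> is additive along steps \<open>n\<close> with \<open>{n a}\<close> tiny, until \<open>{N a}\<close> reaches \<open>1\<close>, where \<open>E\<close> is forced
  to be tiny; so \<open>E\<close> vanishes and \<open>a b - a\<close> is an integer.
\<close>

section \<open>Fractional parts of integer multiples of an irrational number\<close>

lemma frac_add_of_less_one:
  fixes x y :: real
  assumes "frac x + frac y < 1"
  shows "frac (x + y) = frac x + frac y"
  using assms by (simp add: frac_add)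

lemma int_mult_irrational:
  fixes a :: real and n :: int
  assumes "a \<notin> \<rat>" "n \<noteq> 0"
  shows "of_int n * a \<notin> \<rat>" "of_int n * a \<notin> \<int>"
proof -
  show *: "of_int n * a \<notin> \<rat>"
  proof
    assume "of_int n * a \<in> \<rat>"
    then have "of_int n * a / of_int n \<in> \<rat>" by (intro Rats_divide) auto
    with assms show False by simp
  qed
  show "of_int n * a \<notin> \<int>" using * Ints_subset_Rats by blast
qed

text \<open>Dirichlet approximation puts some \<open>k * a\<close> close to an integer, perhaps from
  below; in that case \<open>-k\<close> works, so the sign of \<open>n\<close> is left open.\<close>

lemma irrational_frac_small:
  fixes a e :: real
  assumes "a \<notin> \<rat>" "e > 0"
  obtains n :: int where "n \<noteq> 0" "0 < frac (of_int n * a)" "frac (of_int n * a) < e"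
proof -
  obtain M :: nat where M: "M > 0" "1 / real M < e"
    using assms(2) by (metis nat_approx_posE of_nat_0_less_iff zero_less_Suc)
  obtain h k where k: "0 < k" "\<bar>of_int k * a - of_int h\<bar> < 1 / real M"
    using Dirichlet_approx[OF M(1), of a] by metis
  have "1 / real M \<le> 1" using M(1) by simp
  have ni: "of_int k * a \<notin> \<int>" using int_mult_irrational(2)[OF assms(1)] k(1) by simp
  define x where "x = of_int k * a - of_int h"
  have x: "of_int k * a = x + of_int h" "\<bar>x\<bar> < 1 / real M" "\<bar>x\<bar> < 1"
    using k(2) \<open>1 / real M \<le> 1\<close> by (auto simp: x_def)
  have "x \<noteq> 0" using ni x(1) by auto
  show ?thesis
  proof (cases "x > 0")
    case True
    then have "frac (of_int k * a) = x" using x by (simp add: frac_unique_iff)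
    then show ?thesis using that[of k] k(1) True x M by auto
  next
    case False
    then have "frac (of_int (-k) * a) = - x" using x by (simp add: frac_unique_iff)
    then show ?thesis using that[of "-k"] k(1) False \<open>x \<noteq> 0\<close> x M by auto
  qed
qed

lemma irrational_frac_near_one:
  fixes a e :: real
  assumes "a \<notin> \<rat>" "e > 0"
  obtains n :: int where "n \<noteq> 0" "1 - e < frac (of_int n * a)"
proof -
  obtain n :: int where n: "n \<noteq> 0" "0 < frac (of_int n * a)" "frac (of_int n * a) < e"
    using irrational_frac_small[OF assms] .
  then have "frac (of_int (-n) * a) = 1 - frac (of_int n * a)"
    by (simp add: frac_neg)
  with n show ?thesis using that[of "-n"] by auto
qed

section \<open>Rigidity along the rotation by an irrational number\<close>

text \<open>Applied with \<open>E n = frac (n * a * b) - frac (n * a)\<close>,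
  \<open>c = b - 1\<close> and \<open>d = a * b - a\<close>. Walking from 0 and from 1 with the same
  small step until \<open>F\<close> is nearly 1 makes \<open>E\<close> small at both ends, so
  \<open>E 1\<close> is arbitrarily small.\<close>

lemma rotation_rigidity:
  fixes a c d :: real and E :: "int \<Rightarrow> real"
  defines "F \<equiv> \<lambda>n. frac (of_int n * a)"
  assumes irr: "a \<notin> \<rat>" and c: "0 \<le> c" "c < 1"
    and int: "\<And>n. E n - of_int n * d \<in> \<int>"
    and lo: "\<And>n. - ((1 - F n) * c) \<le> E n" "\<And>n. - F n \<le> E n"
    and hi: "\<And>n. E n \<le> F n * c" "\<And>n. E n \<le> 1 - F n"
  shows "d \<in> \<int>"
proof -
  have F: "0 \<le> F n" "F n < 1" for n
    by (auto simp: F_def frac_lt_1)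
  have small: "x = 0" if "x \<in> \<int>" "\<bar>x\<bar> < 1" for x :: real
    using that Ints_nonzero_abs_less1 by blast
  have F0: "F 0 = 0" by (simp add: F_def)
  have E0: "E 0 = 0"
    using int[of 0] lo(2)[of 0] hi(1)[of 0] F0 by simp
  have bound: "\<bar>E 1\<bar> \<le> 2 * e" if e: "e > 0" for e
  proof -
    \<comment> \<open>The second term of \<open>min\<close> yields \<open>c + 2 * f < 1\<close>,
      which makes the integer \<open>E (N + n) - E N - E n\<close> smaller than 1 in absolute
      value.\<close>
    obtain n where n: "0 < F n" "F n < min e ((1 - c) / 2)"
      using irrational_frac_small[OF irr, of "min e ((1 - c) / 2)"] e c
      unfolding F_def by auto
    define f where "f = F n"
    have f: "0 < f" "f < e" "c + 2 * f < 1" using n by (auto simp: f_def)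
    have fc: "f * c \<le> f" using f c by (simp add: mult_left_le)
    have Fadd: "F (N + n) = F N + f" if "F N + f < 1" for N
      using that frac_add_of_less_one[of "of_int N * a" "of_int n * a"]
      by (simp add: F_def f_def distrib_right)
    \<comment> \<open>Both sides are congruent modulo 1, and the bounds confine \<open>E\<close> to windows of length \<open>c < 1\<close>
      that move by at most \<open>f\<close>.\<close>
    have Eadd: "E (N + n) = E N + E n" if "F N + f < 1" for N
    proof -
      have "(E (N + n) - of_int (N + n) * d) - (E N - of_int N * d) - (E n - of_int n * d) \<in> \<int>"
        by (rule Ints_diff[OF Ints_diff[OF int int] int])
      then have "E (N + n) - E N - E n \<in> \<int>" by (simp add: algebra_simps)
      moreover have "E (N + n) \<le> F N * c + f * c" "- c + F N * c + f * c \<le> E (N + n)"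
        using hi(1)[of "N + n"] lo(1)[of "N + n"] Fadd[OF that] by (auto simp: algebra_simps)
      moreover have "E N \<le> F N * c" "- c + F N * c \<le> E N" "E n \<le> f * c" "- f \<le> E n"
        using hi(1)[of N] lo(1)[of N] hi(1)[of n] lo(2)[of n] by (auto simp: algebra_simps f_def)
      ultimately have "E (N + n) - E N - E n = 0"
        using fc f c by (intro small) linarith+
      then show ?thesis by simp
    qed
    have iter: "F (N + int j * n) = F N + real j * f \<and> E (N + int j * n) = E N + real j * E n"
      if "F N + real j * f < 1" for N j
      using that
    proof (induction j)
      case (Suc j)
      then have *: "F N + real j * f + f < 1" by (simp add: algebra_simps)
      with f Suc.IH have IH: "F (N + int j * n) = F N + real j * f"
        "E (N + int j * n) = E N + real j * E n" by auto
      have "N + int (Suc j) * n = (N + int j * n) + n" by (simp add: algebra_simps)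
      then show ?case
        using Fadd[of "N + int j * n"] Eadd[of "N + int j * n"] IH * by (simp add: algebra_simps)
    qed auto
    have last: "\<exists>j. F N + real j * f < 1 \<and> 1 \<le> F N + (real j + 1) * f \<and> \<bar>E N + real j * E n\<bar> \<le> f" for N
    proof -
      \<comment> \<open>The last step before wrapping; ceiling minus 1, unlike floor, keeps
        \<open>F N + j * f\<close> strictly below 1 even if the quotient is an integer.\<close>
      define j where "j = nat (\<lceil>(1 - F N) / f\<rceil> - 1)"
      have "(1 - F N) / f > 0" using F[of N] f by simp
      then have "real j = of_int \<lceil>(1 - F N) / f\<rceil> - 1" by (simp add: j_def)
      then have "real j < (1 - F N) / f" "(1 - F N) / f \<le> real j + 1" by linarith+
      then have j: "F N + real j * f < 1" "1 \<le> F N + (real j + 1) * f"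
        using f by (auto simp: field_simps)
      define x where "x = F N + real j * f"
      have x: "F (N + int j * n) = x" "E (N + int j * n) = E N + real j * E n"
        using iter[OF j(1)] by (auto simp: x_def)
      have "1 - x \<le> f" "x < 1" using j by (auto simp: x_def algebra_simps)
      moreover from this have "(1 - x) * c \<le> f" using c
        by (metis diff_ge_0_iff_ge less_imp_le mult_left_le order_trans)
      ultimately have "\<bar>E N + real j * E n\<bar> \<le> f"
        using lo(1)[of "N + int j * n"] hi(2)[of "N + int j * n"] x by simp
      with j show ?thesis by blast
    qed
    obtain i where i: "F 1 + real i * f < 1" "\<bar>E 1 + real i * E n\<bar> \<le> f"
      using last[of 1] by blast
    obtain j where j: "1 \<le> (real j + 1) * f" "\<bar>real j * E n\<bar> \<le> f"
      using last[of 0] E0 F0 by auto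
    \<comment> \<open>The walk from 1 starts no lower than the one from 0, so it takes no more
      steps, and its total drift is bounded by \<open>f\<close> as well.\<close>
    have "real i * f < (real j + 1) * f" using i j F(1)[of 1] by linarith
    then have "real i \<le> real j" using f by simp
    then have "\<bar>real i * E n\<bar> \<le> \<bar>real j * E n\<bar>" by (simp add: abs_mult mult_right_mono)
    with i j f show ?thesis by linarith
  qed
  have "E 1 = 0"
  proof (rule ccontr)
    assume "E 1 \<noteq> 0"
    then show False using bound[of "\<bar>E 1\<bar> / 4"] by simp
  qed
  with int[of 1] show ?thesis by simp
qed

section \<open>The floor identity and powers\<close>

text \<open>The identity says that subtracting \<open>frac x * b\<close> moves \<open>x * b\<close>
  into the preceding unit interval between integers.\<close>

lemma floor_identity_iff_frac_bounds:
  fixes x b :: real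
  shows "\<lfloor>of_int \<lfloor>x\<rfloor> * b\<rfloor> + 1 = \<lfloor>x * b\<rfloor> \<longleftrightarrow>
    frac x * b - 1 \<le> frac (x * b) \<and> frac (x * b) < frac x * b"
proof -
  have e: "of_int \<lfloor>x\<rfloor> * b = x * b - frac x * b" by (simp add: frac_def algebra_simps)
  have "\<lfloor>of_int \<lfloor>x\<rfloor> * b\<rfloor> + 1 = \<lfloor>x * b\<rfloor> \<longleftrightarrow> \<lfloor>of_int \<lfloor>x\<rfloor> * b\<rfloor> = \<lfloor>x * b\<rfloor> - 1" by auto
  also have "\<dots> \<longleftrightarrow> of_int (\<lfloor>x * b\<rfloor> - 1) \<le> of_int \<lfloor>x\<rfloor> * b \<and> of_int \<lfloor>x\<rfloor> * b < of_int (\<lfloor>x * b\<rfloor> - 1) + 1"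
    by (rule floor_eq_iff)
  also have "\<dots> \<longleftrightarrow> frac x * b - 1 \<le> frac (x * b) \<and> frac (x * b) < frac x * b"
    unfolding e by (auto simp: frac_def[of "x * b"])
  finally show ?thesis .
qed

text \<open>This turns the bound in the theorem into \<open>b < 2\<close>, since
  \<open>x ^ l\<close> is the power of \<open>x ^ k\<close> with exponent
  \<open>l / k\<close>.\<close>

lemma power_less_powr_iff:
  fixes x :: real
  assumes "x > 0" "k > 0" "l > 0"
  shows "x ^ l < 2 powr (real l / real k) \<longleftrightarrow> x ^ k < 2"
proof -
  have "x ^ l = (x ^ k) powr (real l / real k)"
    using assms by (simp add: powr_powr flip: powr_realpow)
  then show ?thesis
    using assms powr_less_mono2[of "real l / real k" "x ^ k" 2]
      powr_mono2[of "real l / real k" 2 "x ^ k"] by (cases "x ^ k < 2") (auto simp: not_less)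
qed

text \<open>Writing \<open>\<alpha>\<^sup>k = u / v\<close> in lowest terms, \<open>\<alpha>\<^sup>l\<close> equals \<open>m v / (u - v)\<close>, and comparing
  \<open>(\<alpha>\<^sup>l)\<^sup>k\<close> with \<open>(\<alpha>\<^sup>k)\<^sup>l\<close> shows that \<open>v\<close> divides a number coprime to it.\<close>

lemma power_rational_imp_power_int:
  fixes x :: real and l k :: nat and m :: int
  assumes "x > 0" "l > 0" "k > 0" "x ^ l \<in> \<rat>" "x ^ (l + k) - x ^ l = of_int m"
  shows "x ^ k \<in> \<int>"
proof -
  have "x ^ k = 1 + of_int m / x ^ l"
    using assms(1) by (simp add: diff_divide_distrib power_add flip: assms(5))
  then have "x ^ k \<in> \<rat>" using assms(4) by simp
  then obtain u v :: int where uv: "v > 0" "coprime u v" "x ^ k = of_int u / of_int v"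
    by (rule Rats_cases')
  have "x ^ l * (x ^ k - 1) = of_int m" using assms(5) by (simp add: power_add algebra_simps)
  then have 1: "x ^ l * of_int (u - v) = of_int (m * v)"
    using uv by (simp add: field_simps)
  have "(x ^ l) ^ k = (x ^ k) ^ l" by (metis mult.commute power_mult)
  then have 2: "(x ^ l) ^ k * of_int v ^ l = of_int u ^ l"
    using uv by (simp add: power_divide)
  have "of_int (u ^ l * (u - v) ^ k) = (x ^ l * of_int (u - v)) ^ k * of_int v ^ l"
    using 2 by (simp add: power_mult_distrib)
  also have "\<dots> = of_int ((m * v) ^ k * v ^ l)" unfolding 1 by simp
  finally have "u ^ l * (u - v) ^ k = (m * v) ^ k * v ^ l" using of_int_eq_iff by blast
  then have "v dvd u ^ l * (u - v) ^ k" using assms(2) by (simp add: dvd_mult dvd_power)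
  moreover have "coprime v (u ^ l * (u - v) ^ k)"
  proof -
    have "coprime v (u - v)"
      using uv(2) by (metis coprime_commute coprime_iff_gcd_eq_1 gcd_diff1)
    then show ?thesis using uv(2) by (simp add: coprime_commute)
  qed
  ultimately have "is_unit v" by (meson coprime_absorb_left)
  then have "v = 1" using uv(1) by simp
  with uv show ?thesis by simp
qed

section \<open>The two implications\<close>

lemma floor_identity_of_int_difference:
  fixes a b :: real and m n :: int
  assumes "a \<notin> \<rat>" "1 < b" "b < 2" "a * b - a = of_int m" "n \<noteq> 0"
  shows "\<lfloor>of_int \<lfloor>of_int n * a\<rfloor> * b\<rfloor> + 1 = \<lfloor>of_int n * (a * b)\<rfloor>"
proof -
  have "of_int n * a \<notin> \<int>" using int_mult_irrational(2) assms by blast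
  then have f: "0 < frac (of_int n * a)" "frac (of_int n * a) < 1"
    by (auto simp: frac_lt_1)
  have "of_int n * a * b = of_int n * a + of_int (n * m)"
    using arg_cong[OF assms(4), of "(*) (of_int n)"] by (simp add: algebra_simps)
  then have e: "frac (of_int n * a * b) = frac (of_int n * a)" by (simp only: frac_add_of_int_right)
  have "frac (of_int n * a) * (b - 1) \<le> 1 * 1"
    using f assms by (intro mult_mono) auto
  moreover have "frac (of_int n * a) * (b - 1) > 0" using f assms by simp
  ultimately have "\<lfloor>of_int \<lfloor>of_int n * a\<rfloor> * b\<rfloor> + 1 = \<lfloor>of_int n * a * b\<rfloor>"
    unfolding floor_identity_iff_frac_bounds e by (simp add: algebra_simps)
  then show ?thesis by (simp add: mult.assoc)
qed

text \<open>The disjunction in \<open>unit\<close> serves to exclude \<open>b \<le> 1\<close>; for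
  powers of \<alpha> its cases are \<alpha> below, equal to and above 1.\<close>

lemma int_difference_of_floor_identity:
  fixes a b :: real
  assumes b: "b > 0"
    and unit: "0 < a * b" "a * b < 1 \<or> a \<in> \<rat> \<or> b > 1"
    and id: "\<And>n::int. n \<noteq> 0 \<Longrightarrow> \<lfloor>of_int \<lfloor>of_int n * a\<rfloor> * b\<rfloor> + 1 = \<lfloor>of_int n * (a * b)\<rfloor>"
  shows "a * b - a \<in> \<int>" "1 < b" "b < 2"
proof -
  define F where "F = (\<lambda>n::int. frac (of_int n * a))"
  define G where "G = (\<lambda>n::int. frac (of_int n * (a * b)))"
  have bnd: "F n * b - 1 \<le> G n" "G n < F n * b" if "n \<noteq> 0" for n
    using id[OF that] floor_identity_iff_frac_bounds[of "of_int n * a" b]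
    by (auto simp: F_def G_def mult.assoc)
  have F: "0 \<le> F n" "F n < 1" and G: "0 \<le> G n" "G n < 1" for n
    by (auto simp: F_def G_def frac_lt_1)
  have F0: "F n \<noteq> 0" if "n \<noteq> 0" for n using bnd(2)[OF that] G(1)[of n] by auto
  have irr: "a \<notin> \<rat>"
  proof
    assume "a \<in> \<rat>"
    then obtain p q :: int where "q > 0" "a = of_int p / of_int q" by (rule Rats_cases')
    then show False using F0[of q] by (simp add: F_def)
  qed
  have Fm: "F (- n) = 1 - F n" if "n \<noteq> 0" for n
    using F0[OF that] by (auto simp: F_def frac_neg)
  have Gm: "G (- n) = 1 - G n" if "G n \<noteq> 0" for n
    using that by (auto simp: G_def frac_neg)
  have hi: "(1 - F n) * b - 1 \<le> 1 - G n" "1 - G n < (1 - F n) * b" if "n \<noteq> 0" "G n \<noteq> 0" for n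
    using bnd[of "-n"] Fm Gm that by auto
  show b1: "1 < b"
  proof (rule ccontr)
    assume "\<not> 1 < b"
    with unit irr have "G 1 = a * b" by (simp add: G_def frac_eq)
    then have "G 1 \<noteq> 0" using unit by auto
    \<comment> \<open>Adding the strict upper bounds for 1 and -1 gives
      \<open>1 < b\<close>.\<close>
    with hi[of 1] bnd[of 1] \<open>\<not> 1 < b\<close> show False by (simp add: algebra_simps)
  qed
  have irr': "a * b \<notin> \<rat>"
  proof
    assume "a * b \<in> \<rat>"
    then obtain p q :: int where q: "q > 0" "a * b = of_int p / of_int q" by (rule Rats_cases')
    have "of_int q * a \<notin> \<rat>" using int_mult_irrational(1)[OF irr] q by simp
    moreover have "1 - 1 / b > 0" using b1 by simp
    \<comment> \<open>On multiples of \<open>q\<close>, \<open>G\<close> vanishes, while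
      \<open>F\<close> comes close to 1; beyond \<open>1 / b\<close> the lower bound on
      \<open>G\<close> fails.\<close>
    ultimately obtain n where n: "n \<noteq> 0" "1 - (1 - 1 / b) < frac (of_int n * (of_int q * a))"
      using irrational_frac_near_one by blast
    have "of_int (n * q) * (a * b) = of_int (n * p)" using q by simp
    then have "G (n * q) = 0" unfolding G_def by (metis frac_of_int)
    moreover have "F (n * q) > 1 / b" using n(2) by (simp add: F_def mult.assoc)
    ultimately show False using bnd(1)[of "n * q"] n q b by (simp add: field_simps)
  qed
  have G0: "G n \<noteq> 0" if "n \<noteq> 0" for n
    using int_mult_irrational(2)[OF irr' that] by (simp add: G_def)
  have "b \<le> 2"
  proof (rule ccontr)
    assume "\<not> b \<le> 2"
    then have "1 - 2 / b > 0" by simp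
    then obtain n where n: "n \<noteq> 0" "1 - (1 - 2 / b) < F n"
      using irrational_frac_near_one[OF irr] unfolding F_def by blast
    then have "2 < F n * b" using b by (simp add: field_simps)
    with bnd(1)[OF n(1)] G(2)[of n] show False by simp
  qed
  moreover have "b \<noteq> 2"
  proof
    assume "b = 2"
    \<comment> \<open>Below 1/2 doubling does not wrap, so \<open>G n = 2 * F n\<close> violates the
      strict bound. Taking 1 and -1 then forces \<open>F 1 = 1 / 2\<close>.\<close>
    have *: "F n \<ge> 1 / 2" if "n \<noteq> 0" for n
    proof (rule ccontr)
      assume "\<not> F n \<ge> 1 / 2"
      then have "frac (of_int n * a + of_int n * a) = F n + F n"
        unfolding F_def by (intro frac_add_of_less_one) simp
      then have "G n = F n * b" using \<open>b = 2\<close> by (simp add: G_def algebra_simps)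
      with bnd(2)[OF that] show False by simp
    qed
    have "F 1 = 1 / 2" using *[of 1] *[of "-1"] Fm[of 1] by simp
    then have "a = 1 / 2 + of_int \<lfloor>a\<rfloor>" by (simp add: F_def frac_def)
    also have "\<dots> \<in> \<rat>" by simp
    finally show False using irr by simp
  qed
  ultimately show b2: "b < 2" by simp
  have z: "F 0 = 0" "G 0 = 0" by (simp_all add: F_def G_def)
  have "G n - F n - of_int n * (a * b - a) = of_int (\<lfloor>of_int n * a\<rfloor> - \<lfloor>of_int n * (a * b)\<rfloor>)" for n
    by (simp add: G_def F_def frac_def algebra_simps)
  then have "G n - F n - of_int n * (a * b - a) \<in> \<int>" for n
    by (metis Ints_of_int)
  moreover have "- ((1 - F n) * (b - 1)) \<le> G n - F n" for n
    using hi(2)[of n] G0[of n] z b1 by (cases "n = 0") (auto simp: algebra_simps)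
  moreover have "G n - F n \<le> F n * (b - 1)" for n
    using bnd(2)[of n] z by (cases "n = 0") (auto simp: algebra_simps)
  moreover have "- F n \<le> G n - F n" "G n - F n \<le> 1 - F n" for n
    using G[of n] by auto
  moreover have "0 \<le> b - 1" "b - 1 < 1"
    using b1 b2 by auto
  ultimately show "a * b - a \<in> \<int>"
    using rotation_rigidity[OF irr, of "b - 1" "\<lambda>n. G n - F n" "a * b - a"]
    unfolding F_def by blast
qed

theorem theorem1p2:
  fixes l k :: nat and \<alpha> :: real
  assumes "l > 0" and "k > 0" and "\<alpha> > 0"
  shows "\<alpha> ^ (l + k) - \<alpha> ^ l \<in> \<int> \<inter> {1..<2 powr (real l / real k)} \<longleftrightarrow>
    (\<forall>n::int. n \<noteq> 0 \<longrightarrow>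
      \<lfloor>of_int \<lfloor>of_int n * \<alpha> ^ l\<rfloor> * \<alpha> ^ k\<rfloor> + 1 = \<lfloor>of_int n * \<alpha> ^ (l + k)\<rfloor>)"
    (is "?L \<longleftrightarrow> ?R")
proof -
  define a b where "a = \<alpha> ^ l" and "b = \<alpha> ^ k"
  have ab: "\<alpha> ^ (l + k) = a * b" and pos: "a > 0" "b > 0"
    using assms by (auto simp: a_def b_def power_add)
  have less: "a < 2 powr (real l / real k) \<longleftrightarrow> b < 2"
    using power_less_powr_iff assms by (simp add: a_def b_def)
  have diff: "a * b - a = a * (b - 1)" by (simp add: algebra_simps)
  show ?thesis
  proof
    assume L: ?L
    then obtain m where m: "a * b - a = of_int m"
      unfolding ab a_def[symmetric] by (auto elim: Ints_cases)
    have bounds: "1 \<le> a * (b - 1)" "a * (b - 1) < 2 powr (real l / real k)"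
      using L unfolding ab a_def[symmetric] diff by auto
    then have b1: "b > 1" using pos by (smt (verit) mult_nonneg_nonpos)
    have b2: "b < 2"
    proof (rule ccontr)
      assume "\<not> b < 2"
      \<comment> \<open>With the upper bound in \<open>bounds\<close> this places \<open>a\<close>
        below the power of 2, which by \<open>less\<close> means \<open>b < 2\<close>.\<close>
      then have "a \<le> a * (b - 1)" using pos by simp
      with bounds less \<open>\<not> b < 2\<close> show False by simp
    qed
    have "a \<notin> \<rat>"
    proof
      assume "a \<in> \<rat>"
      then have "b \<in> \<int>"
        using power_rational_imp_power_int[of \<alpha> l k m] assms m ab by (simp add: a_def b_def)
      then show False using b1 b2 by (auto elim!: Ints_cases)
    qed
    then show ?R
      using floor_identity_of_int_difference[OF _ b1 b2 m]
      unfolding ab a_def[symmetric] b_def[symmetric] by blast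
  next
    assume ?R
    then have id: "\<lfloor>of_int \<lfloor>of_int n * a\<rfloor> * b\<rfloor> + 1 = \<lfloor>of_int n * (a * b)\<rfloor>" if "n \<noteq> 0" for n :: int
      using that unfolding ab a_def[symmetric] b_def[symmetric] by blast
    have unit: "a * b < 1 \<or> a \<in> \<rat> \<or> b > 1"
    proof (cases \<alpha> "1::real" rule: linorder_cases)
      case less
      then have "\<alpha> ^ (l + k) < 1" using assms by (simp add: power_less_one_iff)
      then show ?thesis by (simp add: ab)
    next
      case equal
      then show ?thesis by (simp add: a_def)
    next
      case greater
      then show ?thesis using assms by (simp add: b_def one_less_power)
    qed
    have "0 < a * b" using pos by simp
    note res = int_difference_of_floor_identity[OF pos(2) this unit id]
    have gt0: "a * (b - 1) > 0" using res(2) pos by simp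
    have "1 \<le> a * b - a" using res(1) gt0 diff by (auto elim!: Ints_cases)
    moreover have "a * b - a < 2 powr (real l / real k)"
    proof -
      have "a * (b - 1) \<le> a" using res(3) pos by (simp add: mult_left_le)
      then show ?thesis using less res(3) diff by simp
    qed
    ultimately show ?L using res(1) unfolding ab a_def[symmetric] by simp
  qed
qed

end
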